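(* A graph $G=(V,E)$ is chordal if and only if the polyhedron $\mathcal{T}(G)$ is binary.
   Context: All graphs are finite and simple. A hole is an induced cycle of length at least 4; a graph is chordal if it has no hole. A clique is a set of pairwise adjacent vertices. For $v\in V$, $\Omega^v$ denotes the set of inclusion-wise maximal cliques of $G$ containing $v$. $\mathcal{C}_T(G)$ is the cone of all $(x,y)\in\mathbb{R}^V\times\mathbb{R}^E$ satisfying $$\sum_{u\in K\setminus\{v\}} y_{uv}\le x_v\quad \forall v\in V,\ K\in\Omega^v;\qquad x_v\ge 0\quad\forall v\in V;\qquad y_e\ge 0\quad\forall e\in E.$$ $\mathcal{T}(G)$ is the intersection of $\mathcal{C}_T(G)$ with the hyperplane $\{(x,y): \sum_{v\in V}x_v-\sum_{e\in E}y_e=1\}$. A polyhedron is called binary if it is a polytope (i.e. it is bounded) and all its extreme points have all coordinates in $\{0,1\}$. *)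

theory Defs
  imports "HOL-Analysis.Analysis" "HOL-Library.Ramsey"
begin

definition simple_graph :: "'a set \<Rightarrow> 'a set set \<Rightarrow> bool" where
  "simple_graph V E \<longleftrightarrow> finite V \<and> E \<subseteq> [V]\<^bsup>2\<^esup>"

definition cycle_edges :: "'a list \<Rightarrow> 'a set set" where
  "cycle_edges p = {{p ! i, p ! (Suc i mod length p)} | i. i < length p}"

text \<open>A cycle is given by the list of its vertices in cyclic order; the last vertex is joined
  back to the first, which is not repeated.\<close>

definition is_cycle :: "'a set \<Rightarrow> 'a set set \<Rightarrow> 'a list \<Rightarrow> bool" where
  "is_cycle V E p \<longleftrightarrow>
     distinct p \<and> 3 \<le> length p \<and> set p \<subseteq> V \<and> cycle_edges p \<subseteq> E"

definition induced_cycle :: "'a set \<Rightarrow> 'a set set \<Rightarrow> 'a list \<Rightarrow> bool" where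
  "induced_cycle V E p \<longleftrightarrow> is_cycle V E p \<and> {e \<in> E. e \<subseteq> set p} = cycle_edges p"

definition hole :: "'a set \<Rightarrow> 'a set set \<Rightarrow> 'a list \<Rightarrow> bool" where
  "hole V E p \<longleftrightarrow> induced_cycle V E p \<and> 4 \<le> length p"

definition chordal :: "'a set \<Rightarrow> 'a set set \<Rightarrow> bool" where
  "chordal V E \<longleftrightarrow> (\<nexists>p. hole V E p)"

definition clique :: "'a set \<Rightarrow> 'a set set \<Rightarrow> 'a set \<Rightarrow> bool" where
  "clique V E K \<longleftrightarrow> K \<subseteq> V \<and> (\<forall>u\<in>K. \<forall>v\<in>K. u \<noteq> v \<longrightarrow> {u, v} \<in> E)"

definition maximal_clique :: "'a set \<Rightarrow> 'a set set \<Rightarrow> 'a set \<Rightarrow> bool" where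
  "maximal_clique V E K \<longleftrightarrow> clique V E K \<and> (\<forall>L. clique V E L \<and> K \<subseteq> L \<longrightarrow> L = K)"

definition max_cliques_at :: "'a set \<Rightarrow> 'a set set \<Rightarrow> 'a \<Rightarrow> 'a set set" where
  "max_cliques_at V E v = {K. maximal_clique V E K \<and> v \<in> K}"

text \<open>Vertices are drawn from a finite type, so that the space of pairs \<open>(x, y)\<close> with
  \<open>x\<close> indexed by all of \<open>'a\<close> and \<open>y\<close> by all of \<open>'a set\<close> is a Euclidean space. The space
  of vectors indexed by \<open>V\<close> and \<open>E\<close> is its coordinate subspace in which the coordinates
  outside \<open>V\<close> and \<open>E\<close> vanish. Taking \<open>V\<close> to be a set instead of the whole type admits
  the graph without vertices.\<close>

definition graph_space :: "'a::finite set \<Rightarrow> 'a set set \<Rightarrow> ((real ^ 'a) \<times> (real ^ ('a set))) set"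
  where
  "graph_space V E = {(x, y). (\<forall>v. v \<notin> V \<longrightarrow> x $ v = 0) \<and> (\<forall>e. e \<notin> E \<longrightarrow> y $ e = 0)}"

definition cone_CT :: "'a::finite set \<Rightarrow> 'a set set \<Rightarrow> ((real ^ 'a) \<times> (real ^ ('a set))) set"
  where
  "cone_CT V E = {(x, y) \<in> graph_space V E.
     (\<forall>v\<in>V. \<forall>K\<in>max_cliques_at V E v. (\<Sum>u\<in>K - {v}. y $ {u, v}) \<le> x $ v) \<and>
     (\<forall>v\<in>V. 0 \<le> x $ v) \<and>
     (\<forall>e\<in>E. 0 \<le> y $ e)}"

definition poly_T :: "'a::finite set \<Rightarrow> 'a set set \<Rightarrow> ((real ^ 'a) \<times> (real ^ ('a set))) set"
  where
  "poly_T V E = cone_CT V E \<inter> {(x, y). (\<Sum>v\<in>V. x $ v) - (\<Sum>e\<in>E. y $ e) = 1}"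

text \<open>The values \<open>p \<bullet> b\<close> for \<open>b \<in> Basis\<close> are the coordinates of \<open>p\<close>; the coordinates of
  a pair \<open>(x, y)\<close> are those of \<open>x\<close> together with those of \<open>y\<close>. The vanishing coordinates
  of points in \<open>graph_space V E\<close> are in \<open>{0, 1}\<close> anyway.\<close>

definition binary_polyhedron :: "'n::euclidean_space set \<Rightarrow> bool" where
  "binary_polyhedron P \<longleftrightarrow>
     polytope P \<and> (\<forall>p. p extreme_point_of P \<longrightarrow> (\<forall>b\<in>Basis. p \<bullet> b \<in> {0, 1}))"

end

(* In a chordal graph every point of the cone is a nonnegative combination of incidence vectors
   of induced subtrees. This goes by induction along a perfect elimination ordering: a
   decomposition for the graph without a simplicial vertex s extends to s, because for each
   neighbour u of s the trees meeting the neighbourhood of s only in u carry enough weight to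
   absorb y_{us}. As a subtree has one vertex more than edges, T(G) is the convex hull of these
   0/1 vectors. Conversely, the incidence vector of a hole lies in the cone and has as many
   vertices as edges, so it is a recession direction of T(G), which is then unbounded. *)
theory Submission
  imports Defs
begin

subsection \<open>Simplicial vertices of chordal graphs\<close>

lemma simple_graph_edgeE:
  assumes "simple_graph V E" "e \<in> E"
  obtains a b where "e = {a, b}" "a \<noteq> b" "a \<in> V" "b \<in> V"
proof -
  have "e \<subseteq> V" "card e = 2"
    using assms by (auto simp: simple_graph_def nsets_def)
  then show thesis
    by (metis card_2_iff insert_subset that)
qed

lemma simple_graph_no_loop: "simple_graph V E \<Longrightarrow> {a, a} \<notin> E"
  by (metis doubleton_eq_iff simple_graph_edgeE)

text \<open>Turns membership in a component, available only as reachability, into a list of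
  vertices. Every listed vertex is itself reachable from \<open>a\<close>, so the walk stays inside
  the component.\<close>

lemma rtrancl_imp_walk:
  assumes "(a, b) \<in> R\<^sup>*"
  shows "\<exists>q. q \<noteq> [] \<and> hd q = a \<and> last q = b \<and> set q \<subseteq> R\<^sup>* `` {a} \<and>
    successively (\<lambda>u v. (u, v) \<in> R) q"
  using assms
proof (induction rule: rtrancl_induct)
  case base
  show ?case by (rule exI[of _ "[a]"]) auto
next
  case (step b c)
  then obtain q where q: "q \<noteq> []" "hd q = a" "last q = b" "set q \<subseteq> R\<^sup>* `` {a}"
    "successively (\<lambda>u v. (u, v) \<in> R) q" by blast
  have "(a, c) \<in> R\<^sup>*"
    using step.hyps by (rule rtrancl_into_rtrancl)
  then show ?case
    using q step.hyps by (intro exI[of _ "q @ [c]"]) (auto simp: successively_append_iff)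
qed

text \<open>A shortest walk from \<open>x\<close> to \<open>y\<close> through \<open>C\<close> has
  neither chords nor repeated vertices, as either would allow a shortcut. Its inner vertices lie in
  \<open>C\<close> and hence are not adjacent to \<open>v\<close>, so putting \<open>v\<close> in
  front closes it up to an induced cycle. As \<open>x\<close> and \<open>y\<close> are distinct and
  nonadjacent, there is an inner vertex, and the cycle has length at least 4.\<close>

lemma walk_imp_hole:
  assumes G: "simple_graph V E"
    and xy: "{v, x} \<in> E" "{v, y} \<in> E" "x \<noteq> y" "{x, y} \<notin> E"
    and C: "C \<subseteq> V" "v \<notin> C" "\<And>c. c \<in> C \<Longrightarrow> {v, c} \<notin> E"
    and walk: "p \<noteq> []" "hd p = x" "last p = y" "set p \<subseteq> insert x (insert y C)"
      "successively (\<lambda>a b. {a, b} \<in> E) p"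
  shows "\<exists>q. hole V E q"
proof -
  define P where "P p \<longleftrightarrow> p \<noteq> [] \<and> hd p = x \<and> last p = y \<and> set p \<subseteq> insert x (insert y C) \<and>
      successively (\<lambda>a b. {a, b} \<in> E) p" for p
  have "P p" using walk by (simp add: P_def)
  then obtain q where Pq: "P q" and least: "\<And>r. P r \<Longrightarrow> length q \<le> length r"
    using ex_has_least_nat[of P p length] by blast
  define n where "n = length q"
  have q: "q \<noteq> []" "hd q = x" "last q = y" "set q \<subseteq> insert x (insert y C)"
    "successively (\<lambda>a b. {a, b} \<in> E) q"
    using Pq by (auto simp: P_def)
  have n0: "0 < n" using q by (simp add: n_def)
  have q0: "q ! 0 = x" and qn: "q ! (n - 1) = y"
    using q by (auto simp: n_def hd_conv_nth last_conv_nth)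
  have consec: "{q ! i, q ! Suc i} \<in> E" if "Suc i < n" for i
    using q(5) that by (auto simp: successively_conv_nth n_def)
  \<comment> \<open>An edge between positions \<open>i\<close> and \<open>j\<close> permits skipping
    everything strictly between them. Minimality of \<open>q\<close> then rules out jumps by more
    than one position.\<close>
  have P_take_drop: "P (take (Suc i) q @ drop j q)"
    if "i < n" "j < n" "{q ! i, q ! j} \<in> E" for i j
    unfolding P_def
  proof (intro conjI)
    have ne: "take (Suc i) q \<noteq> []" "drop j q \<noteq> []"
      using q that by (auto simp: n_def)
    show "take (Suc i) q @ drop j q \<noteq> []" using ne by simp
    show "hd (take (Suc i) q @ drop j q) = x" using ne q by simp
    show "last (take (Suc i) q @ drop j q) = y" using ne q by simp
    show "set (take (Suc i) q @ drop j q) \<subseteq> insert x (insert y C)"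
      using q(4) by (auto dest: in_set_takeD in_set_dropD)
    have "successively (\<lambda>a b. {a, b} \<in> E) (take (Suc i) q)"
      "successively (\<lambda>a b. {a, b} \<in> E) (drop j q)"
      using q(5) by (auto simp: successively_conv_nth)
    moreover have "last (take (Suc i) q) = q ! i" "hd (drop j q) = q ! j"
      using that by (auto simp: n_def take_Suc_conv_app_nth hd_drop_conv_nth)
    ultimately show "successively (\<lambda>a b. {a, b} \<in> E) (take (Suc i) q @ drop j q)"
      using that by (auto simp: successively_append_iff)
  qed
  have chord: "j \<le> Suc i" if "i < j" "j < n" "{q ! i, q ! j} \<in> E" for i j
    using least[OF P_take_drop[of i j]] that by (auto simp: n_def)
  \<comment> \<open>A repeated vertex gives an edge from position \<open>i\<close> to
    \<open>Suc j\<close>, a forbidden jump. If \<open>j\<close> is the last position, the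
    predecessor of \<open>i\<close> and \<open>j\<close> form the jump instead; that predecessor
    exists because \<open>q ! 0 = x\<close> differs from \<open>y\<close>.\<close>
  have neq: "q ! i \<noteq> q ! j" if ij: "i < j" "j < n" for i j
  proof
    assume eq: "q ! i = q ! j"
    show False
    proof (cases "Suc j < n")
      case True
      then have "{q ! i, q ! Suc j} \<in> E" using consec eq by metis
      then show False using chord[of i "Suc j"] ij True by simp
    next
      case False
      then have j: "j = n - 1" using ij by simp
      then have qi: "q ! i = y" using eq qn by simp
      then have "0 < i" using q0 \<open>x \<noteq> y\<close> by (metis gr0I)
      then obtain k where k: "i = Suc k" by (cases i) auto
      then have "{q ! k, q ! j} \<in> E" using consec[of k] ij eq by simp
      then show False using chord[of k j] ij k by simp
    qed
  qed
  have dist: "distinct q"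
    unfolding distinct_conv_nth using neq by (metis n_def nat_neq_iff)
  have n3: "3 \<le> n"
  proof (rule ccontr)
    assume "\<not> 3 \<le> n"
    then have "n = 1 \<or> n = 2" using n0 by linarith
    then show False
    proof
      assume "n = 1" then show False using q0 qn \<open>x \<noteq> y\<close> by simp
    next
      assume "n = 2" then show False using q0 qn consec[of 0] xy(4) by simp
    qed
  qed
  have inner: "q ! i \<in> C" if "0 < i" "i < n - 1" for i
  proof -
    have "q ! i \<in> insert x (insert y C)"
      using q(4) that nth_mem[of i q] unfolding n_def by (meson diff_le_self less_le_trans subsetD)
    moreover have "q ! i \<noteq> x" "q ! i \<noteq> y"
      using neq[of 0 i] neq[of i "n - 1"] that q0 qn by (metis diff_less less_trans n0 zero_less_one)+
    ultimately show ?thesis by simp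
  qed
  have vx: "v \<in> V" "x \<in> V" "y \<in> V" "v \<noteq> x" "v \<noteq> y"
    using G xy simple_graph_no_loop[OF G]
    by (auto simp: simple_graph_def nsets_def)
  have vq: "v \<notin> set q" using q(4) vx C by auto
  have v_adj: "i = 0 \<or> i = n - 1" if "i < n" "{v, q ! i} \<in> E" for i
    using inner[of i] C(3) that by force
  let ?p = "v # q"
  have len: "length ?p = Suc n" by (simp add: n_def)
  \<comment> \<open>Positions in \<open>v # q\<close> are shifted by one against \<open>q\<close>:
    position 0 yields \<open>{v, x}\<close>, and position \<open>n\<close> wraps around to yield
    \<open>{y, v}\<close>.\<close>
  have cyc: "cycle_edges ?p = insert {v, x} (insert {y, v} {{q ! i, q ! Suc i} | i. Suc i < n})"
    (is "_ = ?R")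
  proof
    show "cycle_edges ?p \<subseteq> ?R"
    proof
      fix e assume "e \<in> cycle_edges ?p"
      then obtain i where i: "i < Suc n" "e = {?p ! i, ?p ! (Suc i mod Suc n)}"
        unfolding cycle_edges_def len by blast
      consider "i = 0" | "i = n" "0 < i" | k where "i = Suc k" "Suc k < n"
        using i(1) by (metis less_Suc_eq not0_implies_Suc zero_less_Suc)
      then show "e \<in> ?R"
      proof cases
        case 1 then show ?thesis using i q0 n0 by simp
      next
        case 2 then show ?thesis using i qn by simp
      next
        case 3 then show ?thesis using i by auto
      qed
    qed
    show "?R \<subseteq> cycle_edges ?p"
    proof
      fix e assume "e \<in> ?R"
      then consider "e = {v, x}" | "e = {y, v}" | i where "Suc i < n" "e = {q ! i, q ! Suc i}"
        by blast
      then show "e \<in> cycle_edges ?p"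
      proof cases
        case 1 then show ?thesis
          unfolding cycle_edges_def len using q0 n0 by (auto intro!: exI[of _ 0])
      next
        case 2 then show ?thesis
          unfolding cycle_edges_def len using qn n0 by (auto intro!: exI[of _ n])
      next
        case 3 then show ?thesis
          unfolding cycle_edges_def len by (auto intro!: exI[of _ "Suc i"])
      qed
    qed
  qed
  have sub: "cycle_edges ?p \<subseteq> E"
    unfolding cyc using xy consec by (auto simp: insert_commute)
  have cyc_sub: "e \<subseteq> set ?p" if "e \<in> cycle_edges ?p" for e
    using that q0 qn n0 unfolding cyc by (auto simp: n_def)
  have ind: "e \<in> cycle_edges ?p" if e: "e \<in> E" "e \<subseteq> set ?p" for e
  proof -
    obtain a b where ab: "e = {a, b}" "a \<noteq> b" using simple_graph_edgeE[OF G e(1)] by metis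
    have v_case: "{v, c} \<in> cycle_edges ?p" if "{v, c} \<in> E" "c \<in> set q" for c
    proof -
      obtain i where "i < n" "c = q ! i" using \<open>c \<in> set q\<close> by (auto simp: in_set_conv_nth n_def)
      then show ?thesis using v_adj[of i] that q0 qn unfolding cyc by (auto simp: insert_commute)
    qed
    have q_case: "{q ! i, q ! j} \<in> cycle_edges ?p" if "{q ! i, q ! j} \<in> E" "i < j" "j < n" for i j
      using chord[of i j] that unfolding cyc by (auto simp: le_Suc_eq)
    consider "a = v" "b \<in> set q" | "b = v" "a \<in> set q" | "a \<in> set q" "b \<in> set q"
      using ab e by auto
    then show ?thesis
    proof cases
      case 1 then show ?thesis using v_case ab e by simp
    next
      case 2 then show ?thesis using v_case[of a] ab e by (simp add: insert_commute)
    next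
      case 3
      then obtain i j where ij: "i < n" "a = q ! i" "j < n" "b = q ! j"
        by (auto simp: in_set_conv_nth n_def)
      then have "i < j \<or> j < i" using ab by (metis nat_neq_iff)
      then show ?thesis using q_case[of i j] q_case[of j i] ij ab e by (auto simp: insert_commute)
    qed
  qed
  have "hole V E ?p"
    unfolding hole_def induced_cycle_def is_cycle_def
    using dist vq n3 len sub ind cyc_sub q(4) vx C by auto
  then show ?thesis ..
qed

text \<open>Taken relative to \<open>W\<close>, because the elimination removes vertices from
  \<open>W\<close> while the graph itself stays fixed.\<close>

definition simplicial_in :: "'a set set \<Rightarrow> 'a set \<Rightarrow> 'a \<Rightarrow> bool" where
  "simplicial_in E W z \<longleftrightarrow>
     (\<forall>a\<in>W. \<forall>b\<in>W. {a, z} \<in> E \<and> {b, z} \<in> E \<and> a \<noteq> b \<longrightarrow> {a, b} \<in> E)"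

text \<open>The component \<open>C\<close> of \<open>u\<close> among the non-neighbours of \<open>v\<close> attaches to the rest of \<open>W\<close>
  along a clique \<open>S\<close> of neighbours of \<open>v\<close>: a shortest path through \<open>C\<close> between two nonadjacent
  vertices of \<open>S\<close> would close up to a hole through \<open>v\<close>. Induction on \<open>C \<union> S\<close> gives a simplicial
  vertex outside \<open>S\<close>.\<close>

lemma chordal_ex_simplicial_nonadjacent:
  assumes G: "simple_graph V E" and "chordal V E" and "finite W" "W \<subseteq> V"
    and "v \<in> W" "u \<in> W" "u \<noteq> v" "{u, v} \<notin> E"
  shows "\<exists>z\<in>W. z \<noteq> v \<and> {z, v} \<notin> E \<and> simplicial_in E W z"
  using assms(3-)
proof (induction W arbitrary: u v rule: finite_psubset_induct)
  case (psubset W)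
  define D where "D = {a \<in> W. a \<noteq> v \<and> {a, v} \<notin> E}"
  define R where "R = {(a, b). a \<in> D \<and> b \<in> D \<and> {a, b} \<in> E}"
  define C where "C = R\<^sup>* `` {u}"
  define S where "S = {x \<in> W - C. \<exists>c\<in>C. {x, c} \<in> E}"
  have uD: "u \<in> D" using psubset.prems by (simp add: D_def)
  have "sym R" by (auto simp: sym_def R_def insert_commute)
  have C_sub: "C \<subseteq> D"
  proof
    fix a assume "a \<in> C"
    then have "(u, a) \<in> R\<^sup>*" by (simp add: C_def)
    then show "a \<in> D" by (cases rule: rtranclE) (use uD in \<open>auto simp: R_def\<close>)
  qed
  have C_closed: "a \<in> C" if "c \<in> C" "a \<in> D" "{c, a} \<in> E" for a c
  proof -
    have "(u, c) \<in> R\<^sup>*" "(c, a) \<in> R" using that C_sub by (auto simp: C_def R_def)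
    then show ?thesis by (auto simp: C_def intro: rtrancl_into_rtrancl)
  qed
  have uC: "u \<in> C" by (simp add: C_def)
  \<comment> \<open>A vertex of \<open>D\<close> with a neighbour in \<open>C\<close> belongs to
    \<open>C\<close>, so \<open>x\<close> is outside \<open>D\<close>. It is not \<open>v\<close>
    either, since no vertex of \<open>C\<close> is adjacent to \<open>v\<close>.\<close>
  have S_adj: "{v, x} \<in> E" if "x \<in> S" for x
  proof -
    obtain c where c: "c \<in> C" "{x, c} \<in> E" "x \<in> W" "x \<notin> C" using \<open>x \<in> S\<close> by (auto simp: S_def)
    then have "x \<notin> D" using C_closed[of c x] by (auto simp: insert_commute)
    moreover have "x \<noteq> v" using c C_sub by (auto simp: D_def insert_commute)
    ultimately show ?thesis using c by (auto simp: D_def insert_commute)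
  qed
  have S_clique: "{x, y} \<in> E" if S: "x \<in> S" "y \<in> S" "x \<noteq> y" for x y
  proof (rule ccontr)
    assume nadj: "{x, y} \<notin> E"
    obtain a b where a: "a \<in> C" "{x, a} \<in> E" and b: "b \<in> C" "{y, b} \<in> E"
      using S by (auto simp: S_def)
    have "(u, a) \<in> R\<^sup>*" "(u, b) \<in> R\<^sup>*" using a b by (auto simp: C_def)
    then have "(a, b) \<in> R\<^sup>*" using \<open>sym R\<close> by (meson rtrancl_trans symD sym_rtrancl)
    from rtrancl_imp_walk[OF this] obtain q where q: "q \<noteq> []" "hd q = a" "last q = b"
      "set q \<subseteq> R\<^sup>* `` {a}" "successively (\<lambda>u v. (u, v) \<in> R) q" by blast
    have "set q \<subseteq> C" using q(4) \<open>(u, a) \<in> R\<^sup>*\<close> by (auto simp: C_def)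
    moreover have "successively (\<lambda>u v. {u, v} \<in> E) q"
      using q(5) by (rule successively_mono) (auto simp: R_def)
    moreover have "{v, x} \<in> E" "{v, y} \<in> E"
      using S S_adj by auto
    moreover have "{last q, y} \<in> E" "\<And>c. c \<in> C \<Longrightarrow> {v, c} \<notin> E"
      using q b C_sub by (auto simp: D_def insert_commute)
    ultimately have "\<exists>p. hole V E p"
      using q a b nadj S(3) C_sub psubset.prems
      by (intro walk_imp_hole[OF G, of v x y C "x # q @ [y]"])
        (auto simp: D_def successively_append_iff successively_Cons)
    then show False using \<open>chordal V E\<close> by (simp add: chordal_def)
  qed
  define U where "U = C \<union> S"
  have "v \<notin> U" using C_sub S_adj[of v] simple_graph_no_loop[OF G] by (auto simp: U_def D_def)
  moreover have UW: "U \<subseteq> W" using C_sub by (auto simp: U_def D_def S_def)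
  ultimately have "U \<subset> W" using psubset.prems by auto
  \<comment> \<open>All neighbours in \<open>W\<close> of a vertex of \<open>C\<close> lie in
    \<open>U\<close>, so being simplicial passes from \<open>U\<close> to \<open>W\<close>; and
    vertices of \<open>C\<close> are not adjacent to \<open>v\<close>.\<close>
  have lift: ?case if "z \<in> C" "simplicial_in E U z" for z
  proof -
    have "a \<in> U" if "a \<in> W" "{a, z} \<in> E" for a
      using that \<open>z \<in> C\<close> by (auto simp: U_def S_def)
    then have "simplicial_in E W z"
      using that(2) by (simp add: simplicial_in_def)
    then show ?thesis using that C_sub by (auto simp: D_def)
  qed
  have U_IH: "\<exists>z\<in>U. z \<noteq> w \<and> {z, w} \<notin> E \<and> simplicial_in E U z"
    if "w \<in> U" "t \<in> U" "t \<noteq> w" "{t, w} \<notin> E" for w t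
    using psubset.IH[OF \<open>U \<subset> W\<close> _ that] UW psubset.prems by blast
  \<comment> \<open>It remains to find a simplicial vertex of \<open>U\<close> outside
    \<open>S\<close>. If some \<open>w\<close> in \<open>S\<close> has a non-neighbour in
    \<open>U\<close>, induction gives \<open>z\<close> not adjacent to \<open>w\<close>, which
    cannot lie in the clique \<open>S\<close>. If vertices of \<open>S\<close> are adjacent to all
    others in \<open>U\<close>, then any nonadjacent pair lies in \<open>C\<close>, and so does the
    \<open>z\<close> it yields; without such a pair \<open>U\<close> is a clique and
    \<open>u\<close> will do.\<close>
  show ?case
  proof (cases "\<exists>w\<in>S. \<exists>t\<in>U. t \<noteq> w \<and> {t, w} \<notin> E")
    case True
    then obtain w z where "w \<in> S" "z \<in> U" "z \<noteq> w" "{z, w} \<notin> E" "simplicial_in E U z"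
      using U_IH by (metis UnCI U_def)
    then show ?thesis using S_clique lift by (auto simp: U_def)
  next
    case S_univ: False
    show ?thesis
    proof (cases "\<exists>w\<in>U. \<exists>t\<in>U. t \<noteq> w \<and> {t, w} \<notin> E")
      case True
      then obtain w z where z: "w \<in> U" "z \<in> U" "z \<noteq> w" "{z, w} \<notin> E" "simplicial_in E U z"
        using U_IH by metis
      then have "z \<notin> S" using S_univ by (metis insert_commute)
      then show ?thesis using z lift by (auto simp: U_def)
    next
      case False
      then have "simplicial_in E U u" by (auto simp: simplicial_in_def)
      then show ?thesis using lift uC by blast
    qed
  qed
qed

lemma chordal_ex_simplicial:
  assumes "simple_graph V E" "chordal V E" "W \<subseteq> V" "W \<noteq> {}"
  shows "\<exists>z\<in>W. simplicial_in E W z"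
proof (cases "\<exists>v\<in>W. \<exists>u\<in>W. u \<noteq> v \<and> {u, v} \<notin> E")
  case True
  moreover have "finite W"
    using assms finite_subset by (auto simp: simple_graph_def)
  ultimately show ?thesis
    using chordal_ex_simplicial_nonadjacent[OF assms(1,2) _ assms(3)] by metis
next
  case False
  then show ?thesis using assms(4) unfolding simplicial_in_def by blast
qed

subsection \<open>Decomposition into induced subtrees\<close>

text \<open>In a chordal graph these are exactly the vertex sets of induced subtrees, but only the
  two counting properties are needed.\<close>

definition tree_sets :: "'a set \<Rightarrow> 'a set set \<Rightarrow> 'a set set" where
  "tree_sets V E = {S. S \<subseteq> V \<and> (\<forall>K. clique V E K \<longrightarrow> card (K \<inter> S) \<le> 2) \<and>
     card S = card {e \<in> E. e \<subseteq> S} + 1}"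

lemma edges_insert:
  assumes "simple_graph V E"
  shows "{e \<in> E. e \<subseteq> insert s S} = {e \<in> E. e \<subseteq> S} \<union> (\<lambda>u. {u, s}) ` {u \<in> S. {u, s} \<in> E}"
proof (intro subset_antisym subsetI)
  fix e assume "e \<in> {e \<in> E. e \<subseteq> insert s S}"
  then have e: "e \<in> E" "e \<subseteq> insert s S" by auto
  obtain a b where "e = {a, b}" "a \<noteq> b" using simple_graph_edgeE[OF assms e(1)] by metis
  with e show "e \<in> {e \<in> E. e \<subseteq> S} \<union> (\<lambda>u. {u, s}) ` {u \<in> S. {u, s} \<in> E}"
    by (auto simp: insert_commute)
qed auto

lemma singleton_in_tree_sets:
  assumes "simple_graph V E" "s \<in> V"
  shows "{s} \<in> tree_sets V E"
proof -
  have "{e \<in> E. e \<subseteq> {s}} = {}"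
    using edges_insert[OF assms(1), of s "{}"] simple_graph_edgeE[OF assms(1), of "{}"] by auto
  moreover have "card (K \<inter> {s}) \<le> 2" for K
    using card_mono[of "{s}" "K \<inter> {s}"] by auto
  ultimately show ?thesis
    using assms by (simp add: tree_sets_def)
qed

text \<open>Attaching a leaf adds one vertex and exactly one edge. A clique through \<open>s\<close>
  meets \<open>S\<close> only in neighbours of \<open>s\<close>, hence at most in
  \<open>u\<close>.\<close>

lemma insert_in_tree_sets:
  assumes G: "simple_graph V E" and S: "S \<in> tree_sets V E"
    and s: "s \<in> V" "s \<notin> S" and N: "{w \<in> S. {w, s} \<in> E} = {u}"
  shows "insert s S \<in> tree_sets V E"
proof -
  have fin: "finite V" "finite S" "S \<subseteq> V" "finite E"
    using G S by (auto simp: simple_graph_def tree_sets_def dest: finite_subset)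
      (meson finite_imp_finite_nsets finite_subset)
  have us: "{u, s} \<notin> {e \<in> E. e \<subseteq> S}" using s by auto
  have "{e \<in> E. e \<subseteq> insert s S} = insert {u, s} {e \<in> E. e \<subseteq> S}"
    unfolding edges_insert[OF G] N by auto
  then have "card {e \<in> E. e \<subseteq> insert s S} = Suc (card {e \<in> E. e \<subseteq> S})"
    using us fin by simp
  moreover have "card (K \<inter> insert s S) \<le> 2" if K: "clique V E K" for K
  proof (cases "s \<in> K")
    case True
    have "w = u" if "w \<in> K \<inter> S" for w
    proof -
      have "{w, s} \<in> E" using K True that s by (auto simp: clique_def)
      then have "w \<in> {w \<in> S. {w, s} \<in> E}" using that by simp
      then show ?thesis unfolding N by simp
    qed
    then have "K \<inter> insert s S \<subseteq> {s, u}" by auto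
    then have "card (K \<inter> insert s S) \<le> card {s, u}" by (intro card_mono) auto
    also have "\<dots> \<le> 2" by (simp add: card_insert_if)
    finally show ?thesis .
  next
    case False
    then show ?thesis using K S by (simp add: tree_sets_def)
  qed
  ultimately show ?thesis
    using S s fin by (auto simp: tree_sets_def)
qed

lemma sum_Pow_insert:
  assumes "finite W" "s \<notin> W"
  shows "(\<Sum>S\<in>Pow (insert s W). f S) = (\<Sum>S\<in>Pow W. f S + f (insert s S))"
proof -
  have "inj_on (insert s) (Pow W)"
    using assms by (auto simp: inj_on_def)
  then show ?thesis
    unfolding Pow_insert sum.distrib
    using assms by (subst sum.union_disjoint) (auto simp: sum.reindex)
qed

text \<open>A tree containing \<open>u\<close> has at most one further vertex in the clique
  \<open>N\<close>. So its weight is counted once on the right: in the first sum if there is none,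
  and otherwise in the term of that vertex \<open>w\<close>.\<close>

lemma clique_weight_split:
  fixes l :: "'a set \<Rightarrow> real"
  assumes W: "finite W" and supp: "\<And>S. l S \<noteq> 0 \<Longrightarrow> S \<in> tree_sets V E"
    and N: "clique V E N" "N \<subseteq> W" "u \<in> N"
  shows "(\<Sum>S\<in>Pow W. if u \<in> S then l S else 0) =
    (\<Sum>S\<in>Pow W. if S \<inter> N = {u} then l S else 0) +
    (\<Sum>w\<in>N - {u}. \<Sum>S\<in>Pow W. if {u, w} \<subseteq> S then l S else 0)"
proof -
  have finN: "finite N" using W N finite_subset by blast
  have "(if u \<in> S then l S else 0) =
    (if S \<inter> N = {u} then l S else 0) + (\<Sum>w\<in>N - {u}. if {u, w} \<subseteq> S then l S else 0)" for S
  proof (cases "u \<in> S \<and> l S \<noteq> 0")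
    case True
    have c: "card (N \<inter> S) \<le> 2" using supp[of S] True N by (auto simp: tree_sets_def)
    have eq: "(\<Sum>w\<in>N - {u}. if {u, w} \<subseteq> S then l S else 0) = real (card (N \<inter> S - {u})) * l S"
    proof -
      have "(\<Sum>w\<in>N - {u}. if {u, w} \<subseteq> S then l S else 0) = (\<Sum>w\<in>N \<inter> S - {u}. l S)"
        using True finN by (intro sum.mono_neutral_cong_right) auto
      then show ?thesis by simp
    qed
    have uin: "u \<in> N \<inter> S" using True N by simp
    have c1: "card (N \<inter> S - {u}) \<le> 1"
      using c uin finN by (simp add: card_Diff_singleton)
    show ?thesis
    proof (cases "S \<inter> N = {u}")
      case True
      then have "card (N \<inter> S - {u}) = 0" by (metis Diff_cancel Int_commute card.empty)
      then show ?thesis unfolding eq using True uin by simp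
    next
      case False
      then have "N \<inter> S - {u} \<noteq> {}" using uin by auto
      then have "card (N \<inter> S - {u}) = 1"
        using c1 finN by (metis card_0_eq finite_Diff finite_Int le_eq_less_or_eq less_one)
      then show ?thesis unfolding eq using False uin by simp
    qed
  next
    case False
    then have "(\<Sum>w\<in>N - {u}. if {u, w} \<subseteq> S then l S else 0) = 0"
      by (intro sum.neutral) auto
    then show ?thesis using False by auto
  qed
  then show ?thesis
    by (simp add: sum.distrib sum.swap[of _ "Pow W"])
qed

text \<open>At a simplicial vertex \<open>s\<close> with neighbourhood \<open>N\<close>, the trees meeting \<open>N\<close> only in
  \<open>u\<close> have total weight \<open>x u - (\<Sum>w\<in>N - {u}. y {u, w})\<close>, which the constraint for the clique
  \<open>insert s N\<close> bounds from below by \<open>y {u, s}\<close>. So a fraction of each of them can be extended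
  by the edge \<open>{u, s}\<close>.\<close>

lemma tree_decomposition:
  fixes x :: "'a \<Rightarrow> real" and y :: "'a set \<Rightarrow> real"
  assumes G: "simple_graph V E" and "chordal V E" and "W \<subseteq> V"
    and "\<And>v. v \<in> W \<Longrightarrow> 0 \<le> x v" and "\<And>e. e \<in> E \<Longrightarrow> e \<subseteq> W \<Longrightarrow> 0 \<le> y e"
    and "\<And>v K. v \<in> K \<Longrightarrow> K \<subseteq> W \<Longrightarrow> clique V E K \<Longrightarrow> (\<Sum>u\<in>K - {v}. y {u, v}) \<le> x v"
  shows "\<exists>l :: 'a set \<Rightarrow> real. (\<forall>S. 0 \<le> l S) \<and> (\<forall>S. l S \<noteq> 0 \<longrightarrow> S \<in> tree_sets V E \<and> S \<subseteq> W) \<and>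
    (\<forall>v\<in>W. x v = (\<Sum>S\<in>Pow W. if v \<in> S then l S else 0)) \<and>
    (\<forall>e\<in>E. e \<subseteq> W \<longrightarrow> y e = (\<Sum>S\<in>Pow W. if e \<subseteq> S then l S else 0))"
proof -
  have "finite W" using G \<open>W \<subseteq> V\<close> finite_subset by (auto simp: simple_graph_def)
  then show ?thesis using assms(3-)
  proof (induction W rule: finite_psubset_induct)
    case (psubset W)
    show ?case
    proof (cases "W = {}")
      case True
      have "{} \<notin> E" using simple_graph_edgeE[OF G, of "{}"] by auto
      then show ?thesis using True by (intro exI[of _ "\<lambda>_. 0"]) auto
    next
      case False
      then obtain s where s: "s \<in> W" "simplicial_in E W s"
        using chordal_ex_simplicial[OF G \<open>chordal V E\<close> psubset.prems(1) False] by blast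
      define U where "U = W - {s}"
      have U: "W = insert s U" "s \<notin> U" "finite U" "U \<subset> W"
        using s(1) psubset.hyps(1) by (auto simp: U_def)
      have "\<exists>l :: 'a set \<Rightarrow> real. (\<forall>S. 0 \<le> l S) \<and>
          (\<forall>S. l S \<noteq> 0 \<longrightarrow> S \<in> tree_sets V E \<and> S \<subseteq> U) \<and>
          (\<forall>v\<in>U. x v = (\<Sum>S\<in>Pow U. if v \<in> S then l S else 0)) \<and>
          (\<forall>e\<in>E. e \<subseteq> U \<longrightarrow> y e = (\<Sum>S\<in>Pow U. if e \<subseteq> S then l S else 0))"
      proof (rule psubset.IH[OF U(4)])
        show "U \<subseteq> V" using U(4) psubset.prems(1) by blast
        show "0 \<le> x v" if "v \<in> U" for v using psubset.prems(2) U(4) that by blast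
        show "0 \<le> y e" if "e \<in> E" "e \<subseteq> U" for e using psubset.prems(3) U(4) that by blast
        show "(\<Sum>u\<in>K - {v}. y {u, v}) \<le> x v" if "v \<in> K" "K \<subseteq> U" "clique V E K" for v K
          using psubset.prems(4)[of v K] U(4) that by blast
      qed
      then obtain l :: "'a set \<Rightarrow> real" where l0: "\<forall>S. 0 \<le> l S"
        "\<forall>S. l S \<noteq> 0 \<longrightarrow> S \<in> tree_sets V E \<and> S \<subseteq> U"
        "\<forall>v\<in>U. x v = (\<Sum>S\<in>Pow U. if v \<in> S then l S else 0)"
        "\<forall>e\<in>E. e \<subseteq> U \<longrightarrow> y e = (\<Sum>S\<in>Pow U. if e \<subseteq> S then l S else 0)"
        by - (elim exE conjE, rule that)
      note l = l0(1)[rule_format] l0(2)[rule_format, THEN conjunct1]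
        l0(2)[rule_format, THEN conjunct2] l0(3,4)[rule_format]
      define N where "N = {u \<in> U. {u, s} \<in> E}"
      have NU: "N \<subseteq> U" and finN: "finite N" using U by (auto simp: N_def)
      have N_clique: "clique V E N" and sN_clique: "clique V E (insert s N)"
        using s U psubset.prems unfolding clique_def simplicial_in_def N_def
        by (auto simp: insert_commute)
      define L where "L u = (\<Sum>S\<in>Pow U. if S \<inter> N = {u} then l S else 0)" for u
      have y_us: "0 \<le> y {u, s}" if "u \<in> N" for u
        using psubset.prems(3)[of "{u, s}"] that U by (auto simp: N_def)
      have y_le_L: "y {u, s} \<le> L u" if u: "u \<in> N" for u
      proof -
        have "x u = L u + (\<Sum>w\<in>N - {u}. y {u, w})"
        proof -
          have "y {u, w} = (\<Sum>S\<in>Pow U. if {u, w} \<subseteq> S then l S else 0)" if "w \<in> N - {u}" for w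
          proof (rule l(5))
            show "{u, w} \<in> E" using that u N_clique by (auto simp: clique_def)
            show "{u, w} \<subseteq> U" using that u NU by auto
          qed
          then show ?thesis
            using clique_weight_split[OF \<open>finite U\<close> l(2) N_clique NU u] l(4)[of u] u NU
            unfolding L_def by auto
        qed
        moreover have "(\<Sum>w\<in>insert s N - {u}. y {w, u}) \<le> x u"
          using psubset.prems(4)[OF _ _ sN_clique, of u] u NU U by auto
        moreover have "insert s N - {u} = insert s (N - {u})" "s \<notin> N"
          using u NU U by auto
        ultimately show ?thesis using finN by (simp add: insert_commute)
      qed
      \<comment> \<open>The fraction of the weight of \<open>S\<close> that moves to
        \<open>insert s S\<close>. At most one summand is nonzero, and trees not meeting
        \<open>N\<close> in exactly one vertex are left alone.\<close>
      define r where "r S = (\<Sum>u\<in>N. if S \<inter> N = {u} then y {u, s} / L u else 0)" for S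
      have r_eq: "r S = y {u, s} / L u" if "S \<inter> N = {u}" for S u
      proof -
        have "u \<in> N" using that by auto
        then show ?thesis using finN that by (simp add: r_def sum.delta)
      qed
      have r_0: "r S = 0" if "\<nexists>u. S \<inter> N = {u}" for S
        using that by (auto simp: r_def)
      have r_bounds: "0 \<le> r S" "r S \<le> 1" for S
      proof -
        have "0 \<le> r S \<and> r S \<le> 1"
        proof (cases "\<exists>u. S \<inter> N = {u}")
          case True
          then obtain u where u: "S \<inter> N = {u}" "u \<in> N" by blast
          then show ?thesis
            using r_eq[OF u(1)] y_us[OF u(2)] y_le_L[OF u(2)] by (auto simp: divide_le_eq_1)
        qed (simp add: r_0)
        then show "0 \<le> r S" "r S \<le> 1" by auto
      qed
      have sum_lr: "(\<Sum>S\<in>Pow U. if S \<inter> N = {u} then l S * r S else 0) = y {u, s}" if u: "u \<in> N" for u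
      proof -
        have "(\<Sum>S\<in>Pow U. if S \<inter> N = {u} then l S * r S else 0) = L u * (y {u, s} / L u)"
          unfolding L_def[of u] sum_distrib_right
          by (intro sum.cong) (auto simp: r_eq L_def)
        \<comment> \<open>If \<open>L u = 0\<close>, the bounds force \<open>y {u, s} = 0\<close>,
          which agrees with the value of division by zero.\<close>
        also have "\<dots> = y {u, s}" using y_us[OF u] y_le_L[OF u] by (cases "L u = 0") auto
        finally show ?thesis .
      qed
      define c where "c = x s - (\<Sum>u\<in>N. y {u, s})"
      have "0 \<le> c"
      proof -
        have "insert s N - {s} = N" using NU U by auto
        then show ?thesis
          using psubset.prems(4)[OF _ _ sN_clique, of s] NU U by (auto simp: c_def)
      qed
      define m where "m T = (if s \<in> T then l (T - {s}) * r (T - {s}) + (if T = {s} then c else 0)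
          else l T * (1 - r T))" for T
      have m_simps: "m S = l S * (1 - r S)" "m (insert s S) = l S * r S + (if S = {} then c else 0)"
        if "S \<in> Pow U" for S
      proof -
        have "s \<notin> S" using that U by auto
        moreover from this have "insert s S = {s} \<longleftrightarrow> S = {}" by auto
        ultimately show "m S = l S * (1 - r S)" "m (insert s S) = l S * r S + (if S = {} then c else 0)"
          by (simp_all add: m_def)
      qed
      have lr_tree: "insert s S \<in> tree_sets V E" if nz: "l S * r S \<noteq> 0" for S
      proof -
        have S: "l S \<noteq> 0" "S \<subseteq> U" using nz l(3) by auto
        obtain u where "S \<inter> N = {u}" using nz r_0 by force
        then have "{w \<in> S. {w, s} \<in> E} = {u}" using S(2) unfolding N_def by blast
        moreover have "s \<in> V" "s \<notin> S" using s(1) psubset.prems(1) S(2) U(2) by auto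
        ultimately show ?thesis using insert_in_tree_sets[OF G l(2)[OF S(1)]] by metis
      qed
      have "0 \<le> m T" for T
        using l(1) r_bounds \<open>0 \<le> c\<close> by (simp add: m_def)
      moreover have "T \<in> tree_sets V E \<and> T \<subseteq> W" if T: "m T \<noteq> 0" for T
      proof (cases "s \<in> T")
        case True
        show ?thesis
        proof (cases "T = {s}")
          case True
          then show ?thesis using singleton_in_tree_sets[OF G] s psubset.prems by auto
        next
          case False
          then have "l (T - {s}) * r (T - {s}) \<noteq> 0" using T True by (simp add: m_def)
          then show ?thesis
            using lr_tree[of "T - {s}"] l(3)[of "T - {s}"] True U by (auto simp: insert_absorb)
        qed
      next
        case False
        then have "l T \<noteq> 0" using T by (auto simp: m_def)
        then show ?thesis using l(2,3) U by blast
      qed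
      moreover have "x v = (\<Sum>S\<in>Pow W. if v \<in> S then m S else 0)" if "v \<in> W" for v
      proof (cases "v = s")
        case True
        have "(\<Sum>S\<in>Pow W. if v \<in> S then m S else 0) =
            (\<Sum>S\<in>Pow U. l S * r S + (if S = {} then c else 0))"
          unfolding U(1) sum_Pow_insert[OF U(3,2)]
          using True U by (intro sum.cong) (auto simp: m_simps)
        also have "\<dots> = (\<Sum>S\<in>Pow U. l S * r S) + c"
          using U by (simp add: sum.distrib sum.delta)
        \<comment> \<open>Group the extended trees by the unique neighbour \<open>u\<close> of
          \<open>s\<close> they contain; each group has total weight
          \<open>y {u, s}\<close>.\<close>
        also have "(\<Sum>S\<in>Pow U. l S * r S) = (\<Sum>S\<in>Pow U. \<Sum>u\<in>N. if S \<inter> N = {u} then l S * r S else 0)"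
        proof (intro sum.cong refl)
          fix S
          show "l S * r S = (\<Sum>u\<in>N. if S \<inter> N = {u} then l S * r S else 0)"
          proof (cases "\<exists>u. S \<inter> N = {u}")
            case True
            then obtain u where "S \<inter> N = {u}" "u \<in> N" by blast
            then show ?thesis using finN by (simp add: sum.delta)
          qed (simp add: r_0)
        qed
        also have "\<dots> = (\<Sum>u\<in>N. y {u, s})"
          by (subst sum.swap) (simp add: sum_lr)
        finally show ?thesis using True by (simp add: c_def)
      next
        case False
        \<comment> \<open>The share kept by \<open>S\<close> and the share moved to
          \<open>insert s S\<close> add up to \<open>l S\<close>, so coordinates away from
          \<open>s\<close> do not change.\<close>
        then have "(\<Sum>S\<in>Pow W. if v \<in> S then m S else 0) = (\<Sum>S\<in>Pow U. if v \<in> S then l S else 0)"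
          unfolding U(1) sum_Pow_insert[OF U(3,2)]
          by (intro sum.cong) (auto simp: m_simps algebra_simps)
        then show ?thesis using l(4)[of v] that False U by auto
      qed
      moreover have "y e = (\<Sum>S\<in>Pow W. if e \<subseteq> S then m S else 0)" if e: "e \<in> E" "e \<subseteq> W" for e
      proof (cases "e \<subseteq> U")
        case True
        have "e \<noteq> {}" using simple_graph_edgeE[OF G e(1)] by blast
        have "e \<subseteq> insert s S \<longleftrightarrow> e \<subseteq> S" for S using True U by auto
        then have "(\<Sum>S\<in>Pow W. if e \<subseteq> S then m S else 0) = (\<Sum>S\<in>Pow U. if e \<subseteq> S then l S else 0)"
          unfolding U(1) sum_Pow_insert[OF U(3,2)]
          using \<open>e \<noteq> {}\<close> by (intro sum.cong) (auto simp: m_simps algebra_simps)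
        then show ?thesis using l(5)[OF e(1) True] by simp
      next
        case False
        obtain a b where ab: "e = {a, b}" "a \<noteq> b" using simple_graph_edgeE[OF G e(1)] by metis
        then have "a = s \<and> b \<in> U \<or> b = s \<and> a \<in> U" using False e(2) U(1) by auto
        then obtain u where u: "e = {u, s}" "u \<in> U" using ab(1) by (metis insert_commute)
        then have uN: "u \<in> N" using e by (simp add: N_def)
        \<comment> \<open>The sets containing \<open>{u, s}\<close> are the
          \<open>insert s S\<close> with \<open>u\<close> in \<open>S\<close>; if \<open>S\<close>
          contains further neighbours of \<open>s\<close>, no weight was moved.\<close>
        have "(\<Sum>S\<in>Pow W. if e \<subseteq> S then m S else 0) =
          (\<Sum>S\<in>Pow U. if S \<inter> N = {u} then l S * r S else 0)"
          unfolding U(1) sum_Pow_insert[OF U(3,2)]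
        proof (intro sum.cong refl)
          fix S assume S: "S \<in> Pow U"
          have "\<not> e \<subseteq> S" "e \<subseteq> insert s S \<longleftrightarrow> u \<in> S" using u S U by auto
          moreover have "l S * r S = 0" if "u \<in> S" "S \<inter> N \<noteq> {u}"
          proof -
            have "u \<in> S \<inter> N" using that(1) uN by simp
            then have "\<nexists>u'. S \<inter> N = {u'}" using that(2) by (metis singletonD)
            then show ?thesis by (simp add: r_0)
          qed
          ultimately show "(if e \<subseteq> S then m S else 0) + (if e \<subseteq> insert s S then m (insert s S) else 0) =
              (if S \<inter> N = {u} then l S * r S else 0)"
            using S by (auto simp: m_simps)
        qed
        then show ?thesis using sum_lr[OF uN] u by simp
      qed
      ultimately show ?thesis by (intro exI[of _ m]) simp
    qed
  qed
qed

subsection \<open>The polyhedron\<close>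

lemma clique_extends_maximal:
  assumes "finite V" "clique V E K"
  obtains M where "maximal_clique V E M" "K \<subseteq> M"
proof -
  have "finite {M. clique V E M \<and> K \<subseteq> M}"
    using assms by (auto simp: clique_def intro: finite_subset[of _ "Pow V"])
  then obtain M where "M \<in> {M. clique V E M \<and> K \<subseteq> M}"
    "\<And>L. L \<in> {M. clique V E M \<and> K \<subseteq> M} \<Longrightarrow> M \<subseteq> L \<Longrightarrow> M = L"
    using finite_has_maximal[of "{M. clique V E M \<and> K \<subseteq> M}"] assms by auto
  then have "maximal_clique V E M" "K \<subseteq> M"
    by (auto simp: maximal_clique_def)
  then show thesis by (rule that)
qed

text \<open>Used for trees, where it gives the generators of the polytope, and for holes, where it
  gives a recession direction.\<close>

definition subgraph_vec :: "'a::finite set set \<Rightarrow> 'a set \<Rightarrow> (real ^ 'a) \<times> (real ^ 'a set)" where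
  "subgraph_vec E S = (\<chi> v. of_bool (v \<in> S), \<chi> e. of_bool (e \<in> E \<and> e \<subseteq> S))"

text \<open>For \<open>v\<close> in \<open>S\<close>, a clique through \<open>v\<close> has at most
  one further vertex in \<open>S\<close>, so the sum is at most 1. For \<open>v\<close> outside
  \<open>S\<close> every term vanishes.\<close>

lemma subgraph_vec_in_cone_CT:
  assumes "S \<subseteq> V" and K: "\<And>K. clique V E K \<Longrightarrow> card (K \<inter> S) \<le> 2"
  shows "subgraph_vec E S \<in> cone_CT V E"
proof -
  have "(\<Sum>u\<in>K - {v}. of_bool ({u, v} \<in> E \<and> {u, v} \<subseteq> S) :: real) \<le> of_bool (v \<in> S)"
    if "v \<in> V" "K \<in> max_cliques_at V E v" for v K
  proof (cases "v \<in> S")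
    case True
    have KV: "clique V E K" "v \<in> K"
      using that by (auto simp: max_cliques_at_def maximal_clique_def)
    have "(\<Sum>u\<in>K - {v}. of_bool ({u, v} \<in> E \<and> {u, v} \<subseteq> S) :: real) \<le>
        (\<Sum>u\<in>K - {v}. of_bool (u \<in> S))"
      by (intro sum_mono) auto
    also have "\<dots> = real (card ((K \<inter> S) - {v}))"
    proof -
      have "(K - {v}) \<inter> {u. u \<in> S} = (K \<inter> S) - {v}" by auto
      then show ?thesis by (simp add: sum_of_bool_eq)
    qed
    also have "\<dots> \<le> 1"
      using K[OF KV(1)] True KV(2) by (simp add: card_Diff_singleton)
    finally show ?thesis using True by simp
  qed simp
  then show ?thesis
    using assms(1) by (auto simp: subgraph_vec_def cone_CT_def graph_space_def)
qed

text \<open>The linear functional of the hyperplane. On an induced subgraph it counts vertices minus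
  edges: 1 for a tree, 0 for a hole.\<close>

definition excess :: "'a set \<Rightarrow> 'a set set \<Rightarrow> (real ^ 'a) \<times> (real ^ 'a set) \<Rightarrow> real" where
  "excess V E p = (\<Sum>v\<in>V. fst p $ v) - (\<Sum>e\<in>E. snd p $ e)"

lemma poly_T_eq: "poly_T V E = {p \<in> cone_CT V E. excess V E p = 1}"
  by (auto simp: poly_T_def excess_def)

lemma excess_subgraph_vec:
  fixes V :: "'a::finite set"
  assumes "S \<subseteq> V"
  shows "excess V E (subgraph_vec E S) = real (card S) - real (card {e \<in> E. e \<subseteq> S})"
proof -
  have "V \<inter> {v. v \<in> S} = S" "E \<inter> {e. e \<subseteq> S} = {e \<in> E. e \<subseteq> S}"
    using assms by auto
  then show ?thesis
    by (simp add: excess_def subgraph_vec_def sum_of_bool_eq)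
qed

lemma excess_add: "excess V E (p + q) = excess V E p + excess V E q"
  by (simp add: excess_def sum.distrib)

lemma excess_scaleR: "excess V E (c *\<^sub>R p) = c * excess V E p"
  by (simp add: excess_def sum_distrib_left right_diff_distrib)

lemma excess_sum: "excess V E (\<Sum>i\<in>I. f i) = (\<Sum>i\<in>I. excess V E (f i))"
proof (induction I rule: infinite_finite_induct)
  case (insert i I)
  then show ?case by (simp add: excess_add)
qed (simp_all add: excess_def)

lemma cone_CT_add:
  assumes "p \<in> cone_CT V E" "q \<in> cone_CT V E"
  shows "p + q \<in> cone_CT V E"
  using assms
  by (force simp: cone_CT_def graph_space_def sum.distrib intro: add_mono)

lemma cone_CT_scaleR:
  assumes "p \<in> cone_CT V E" "0 \<le> c"
  shows "c *\<^sub>R p \<in> cone_CT V E"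
  using assms
  by (auto simp: cone_CT_def graph_space_def simp flip: sum_distrib_left intro!: mult_left_mono)

lemma convex_poly_T: "convex (poly_T V E)"
  unfolding convex_def poly_T_eq
  by (simp add: cone_CT_add cone_CT_scaleR excess_add excess_scaleR)

lemma subgraph_vec_tree_in_poly_T:
  fixes V :: "'a::finite set"
  assumes "S \<in> tree_sets V E"
  shows "subgraph_vec E S \<in> poly_T V E"
proof -
  have "subgraph_vec E S \<in> cone_CT V E"
    using assms by (intro subgraph_vec_in_cone_CT) (auto simp: tree_sets_def)
  then show ?thesis
    using assms by (auto simp: poly_T_eq excess_subgraph_vec tree_sets_def)
qed

text \<open>Enlarging \<open>K\<close> to a maximal clique only adds nonnegative edge terms. The
  decomposition needs this because the cliques met during the elimination may fail to be maximal in
  the whole graph.\<close>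

lemma cone_CT_clique:
  fixes V :: "'a::finite set"
  assumes p: "(x, y) \<in> cone_CT V E"
    and K: "v \<in> K" "clique V E K"
  shows "(\<Sum>u\<in>K - {v}. y $ {u, v}) \<le> x $ v"
proof -
  obtain M where M: "maximal_clique V E M" "K \<subseteq> M"
    using clique_extends_maximal[OF finite K(2)] by blast
  have "v \<in> V" "M \<in> max_cliques_at V E v"
    using K M by (auto simp: clique_def max_cliques_at_def)
  have "0 \<le> y $ {u, v}" if "u \<in> M - K" for u
  proof -
    have "clique V E M" "u \<in> M" "v \<in> M" "u \<noteq> v"
      using M K(1) that by (auto simp: maximal_clique_def)
    then have "{u, v} \<in> E" by (simp add: clique_def)
    then show ?thesis using p by (auto simp: cone_CT_def)
  qed
  then have "(\<Sum>u\<in>K - {v}. y $ {u, v}) \<le> (\<Sum>u\<in>M - {v}. y $ {u, v})"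
    using M by (intro sum_mono2) auto
  also have "\<dots> \<le> x $ v"
    using p \<open>v \<in> V\<close> \<open>M \<in> max_cliques_at V E v\<close> by (auto simp: cone_CT_def)
  finally show ?thesis .
qed

section \<open>Chordal graphs: the polyhedron as a hull of tree vectors\<close>

lemma chordal_poly_T_eq_convex_hull:
  fixes V :: "'a::finite set"
  assumes G: "simple_graph V E" and "chordal V E"
  shows "poly_T V E = convex hull (subgraph_vec E ` tree_sets V E)"
proof (intro subset_antisym subsetI)
  show "p \<in> poly_T V E" if "p \<in> convex hull (subgraph_vec E ` tree_sets V E)" for p
  proof -
    have "convex hull (subgraph_vec E ` tree_sets V E) \<subseteq> poly_T V E"
      by (intro hull_minimal image_subsetI subgraph_vec_tree_in_poly_T convex_poly_T)
    then show ?thesis using that by (rule subsetD)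
  qed
next
  fix p assume pT: "p \<in> poly_T V E"
  obtain x y where p: "p = (x, y)" by force
  have cone: "(x, y) \<in> cone_CT V E" and one: "excess V E p = 1"
    using pT p by (auto simp: poly_T_eq)
  have "\<exists>l :: 'a set \<Rightarrow> real. (\<forall>S. 0 \<le> l S) \<and> (\<forall>S. l S \<noteq> 0 \<longrightarrow> S \<in> tree_sets V E \<and> S \<subseteq> V) \<and>
    (\<forall>v\<in>V. x $ v = (\<Sum>S\<in>Pow V. if v \<in> S then l S else 0)) \<and>
    (\<forall>e\<in>E. e \<subseteq> V \<longrightarrow> y $ e = (\<Sum>S\<in>Pow V. if e \<subseteq> S then l S else 0))"
  proof (rule tree_decomposition[OF assms])
    show "0 \<le> x $ v" if "v \<in> V" for v using cone that by (auto simp: cone_CT_def)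
    show "0 \<le> y $ e" if "e \<in> E" for e using cone that by (auto simp: cone_CT_def)
    show "(\<Sum>u\<in>K - {v}. y $ {u, v}) \<le> x $ v" if "v \<in> K" "clique V E K" for v K
      by (rule cone_CT_clique[OF cone that])
  qed simp
  then obtain l :: "'a set \<Rightarrow> real" where l: "\<forall>S. 0 \<le> l S"
    "\<forall>S. l S \<noteq> 0 \<longrightarrow> S \<in> tree_sets V E \<and> S \<subseteq> V"
    "\<forall>v\<in>V. x $ v = (\<Sum>S\<in>Pow V. if v \<in> S then l S else 0)"
    "\<forall>e\<in>E. e \<subseteq> V \<longrightarrow> y $ e = (\<Sum>S\<in>Pow V. if e \<subseteq> S then l S else 0)"
    by - (elim exE conjE, rule that)
  let ?T = "tree_sets V E"
  have to_T: "(\<Sum>S\<in>Pow V. if P S then l S else 0) = (\<Sum>S\<in>?T. l S * of_bool (P S))" for P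
    using l(2) by (intro sum.mono_neutral_cong_right) (auto simp: tree_sets_def)
  have "fst p $ v = (\<Sum>S\<in>?T. l S * of_bool (v \<in> S))" for v
  proof (cases "v \<in> V")
    case True
    then show ?thesis using l(3) by (simp add: p to_T)
  next
    case False
    then have "x $ v = 0" using cone by (auto simp: cone_CT_def graph_space_def)
    moreover have "v \<notin> S" if "S \<in> ?T" for S using that False by (auto simp: tree_sets_def)
    ultimately show ?thesis by (simp add: p)
  qed
  moreover have "snd p $ e = (\<Sum>S\<in>?T. l S * of_bool (e \<in> E \<and> e \<subseteq> S))" for e
  proof (cases "e \<in> E")
    case True
    then have "e \<subseteq> V" using simple_graph_edgeE[OF G] by (metis empty_subsetI insert_subset)
    then show ?thesis using l(4) True by (simp add: p to_T)
  next
    case False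
    then have "y $ e = 0" using cone by (auto simp: cone_CT_def graph_space_def)
    then show ?thesis using False by (simp add: p)
  qed
  ultimately have p_eq: "p = (\<Sum>S\<in>?T. l S *\<^sub>R subgraph_vec E S)"
    by (simp add: prod_eq_iff vec_eq_iff subgraph_vec_def fst_sum snd_sum)
  \<comment> \<open>Applying \<open>excess\<close> to the decomposition of \<open>p\<close> turns
    the hyperplane equation into the statement that the weights sum to 1.\<close>
  have "excess V E (subgraph_vec E S) = 1" if "S \<in> ?T" for S
    using subgraph_vec_tree_in_poly_T[OF that] by (simp add: poly_T_eq)
  then have "sum l ?T = 1"
    using one by (simp add: p_eq excess_sum excess_scaleR)
  then show "p \<in> convex hull (subgraph_vec E ` ?T)"
    unfolding p_eq using l(1)
    by (intro convex_sum convex_convex_hull) (auto intro: hull_inc)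
qed

text \<open>Extreme points of the hull of a finite set belong to that set, and here all its members
  are 0/1 vectors.\<close>

lemma chordal_imp_binary:
  fixes V :: "'a::finite set"
  assumes "simple_graph V E" "chordal V E"
  shows "binary_polyhedron (poly_T V E)"
  unfolding binary_polyhedron_def chordal_poly_T_eq_convex_hull[OF assms]
proof (intro conjI allI impI ballI)
  show "polytope (convex hull (subgraph_vec E ` tree_sets V E))"
    by (intro polytope_convex_hull) simp
  fix p b
  assume "p extreme_point_of convex hull (subgraph_vec E ` tree_sets V E)"
    and b: "b \<in> (Basis :: ((real ^ 'a) \<times> (real ^ 'a set)) set)"
  then obtain S where "p = subgraph_vec E S"
    using extreme_point_of_convex_hull by blast
  then show "p \<bullet> b \<in> {0, 1}"
    using b by (auto simp: Basis_prod_def Basis_vec_def inner_axis subgraph_vec_def)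
qed

section \<open>Holes make the polyhedron unbounded\<close>

text \<open>Three vertices of a clique on the hole would be pairwise consecutive in the cyclic
  order, which happens only on a cycle of length 3.\<close>

lemma hole_clique_card:
  assumes h: "hole V E p" and K: "clique V E K"
  shows "card (K \<inter> set p) \<le> 2"
proof (rule ccontr)
  assume "\<not> card (K \<inter> set p) \<le> 2"
  then have "3 \<le> card (K \<inter> set p)" by simp
  then obtain A where A: "A \<subseteq> K \<inter> set p" "card A = 3"
    by (metis obtain_subset_with_card_n)
  let ?n = "length p"
  have d: "distinct p" and n: "4 \<le> ?n" and ind: "\<And>e. e \<in> E \<Longrightarrow> e \<subseteq> set p \<Longrightarrow> e \<in> cycle_edges p"
    using h by (auto simp: hole_def induced_cycle_def is_cycle_def)
  have adj: "j = Suc i mod ?n \<or> i = Suc j mod ?n"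
    if ij: "i < ?n" "j < ?n" "i \<noteq> j" "p ! i \<in> A" "p ! j \<in> A" for i j
  proof -
    have "p ! i \<noteq> p ! j" using ij d by (simp add: nth_eq_iff_index_eq)
    then have "{p ! i, p ! j} \<in> E" using K A ij by (auto simp: clique_def)
    then have "{p ! i, p ! j} \<in> cycle_edges p" using ij by (intro ind) auto
    then obtain k where k: "k < ?n" "{p ! i, p ! j} = {p ! k, p ! (Suc k mod ?n)}"
      by (auto simp: cycle_edges_def)
    have "Suc k mod ?n < ?n" using n by (intro mod_less_divisor) auto
    then show ?thesis using k ij d by (auto simp: doubleton_eq_iff nth_eq_iff_index_eq)
  qed
  obtain a b c where abc: "A = {a, b, c}" "a \<noteq> b" "b \<noteq> c" "a \<noteq> c"
    using A(2) by (auto simp: card_3_iff)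
  then obtain i j k where ijk: "i < ?n" "j < ?n" "k < ?n" "a = p ! i" "b = p ! j" "c = p ! k"
    using A(1) by (auto simp: in_set_conv_nth)
  then have ne: "i \<noteq> j" "j \<noteq> k" "i \<noteq> k" using abc by auto
  have m: "Suc t mod ?n = (if Suc t = ?n then 0 else Suc t)" if "t < ?n" for t
    using that by auto
  have "j = Suc i mod ?n \<or> i = Suc j mod ?n" "k = Suc j mod ?n \<or> j = Suc k mod ?n"
    "k = Suc i mod ?n \<or> i = Suc k mod ?n"
    using adj[of i j] adj[of j k] adj[of i k] ijk ne abc by auto
  then show False
    unfolding m[OF ijk(1)] m[OF ijk(2)] m[OF ijk(3)] using ne n ijk(1-3)
    by (auto split: if_splits)
qed

text \<open>Two different positions giving the same edge would each be the cyclic successor of the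
  other, which needs length 2.\<close>

lemma card_cycle_edges:
  assumes "distinct p" "3 \<le> length p"
  shows "card (cycle_edges p) = length p"
proof -
  let ?n = "length p"
  have "inj_on (\<lambda>i. {p ! i, p ! (Suc i mod ?n)}) {..<?n}"
  proof (rule inj_onI)
    fix i j assume ij: "i \<in> {..<?n}" "j \<in> {..<?n}"
      and eq: "{p ! i, p ! (Suc i mod ?n)} = {p ! j, p ! (Suc j mod ?n)}"
    have lt: "Suc i mod ?n < ?n" "Suc j mod ?n < ?n"
      using assms by (auto intro!: mod_less_divisor)
    have m: "Suc t mod ?n = (if Suc t = ?n then 0 else Suc t)" if "t < ?n" for t
      using that by auto
    have "i = j \<or> (i = Suc j mod ?n \<and> j = Suc i mod ?n)"
      using eq ij lt assms(1) by (auto simp: doubleton_eq_iff nth_eq_iff_index_eq)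
    then show "i = j"
      using ij assms(2) m[of i] m[of j] by (auto split: if_splits)
  qed
  moreover have "cycle_edges p = (\<lambda>i. {p ! i, p ! (Suc i mod ?n)}) ` {..<?n}"
    by (auto simp: cycle_edges_def)
  ultimately show ?thesis by (simp add: card_image)
qed

text \<open>The ray starts at the vector of a single vertex \<open>v\<close> of the hole and follows
  the vector of the hole. The excess stays 1 along it, while the coordinate at \<open>v\<close> is
  \<open>1 + t\<close>.\<close>

lemma hole_imp_unbounded:
  fixes V :: "'a::finite set"
  assumes G: "simple_graph V E" and h: "hole V E p"
  shows "\<not> bounded (poly_T V E)"
proof
  assume "bounded (poly_T V E)"
  then obtain B where B: "\<And>q. q \<in> poly_T V E \<Longrightarrow> norm q \<le> B"
    by (auto simp: bounded_iff)
  have p: "distinct p" "4 \<le> length p" "set p \<subseteq> V" "{e \<in> E. e \<subseteq> set p} = cycle_edges p"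
    using h by (auto simp: hole_def induced_cycle_def is_cycle_def)
  let ?d = "subgraph_vec E (set p)"
  have d_cone: "?d \<in> cone_CT V E"
    using subgraph_vec_in_cone_CT[OF p(3) hole_clique_card[OF h]] .
  have d_excess: "excess V E ?d = 0"
    using p by (simp add: excess_subgraph_vec card_cycle_edges distinct_card)
  have "p \<noteq> []" using p(2) by auto
  then obtain v where v: "v \<in> set p" by (meson list.set_sel(1))
  let ?q = "subgraph_vec E {v}"
  have q: "?q \<in> poly_T V E"
    using v p(3) by (intro subgraph_vec_tree_in_poly_T singleton_in_tree_sets[OF G]) auto
  have "?q + t *\<^sub>R ?d \<in> poly_T V E" if "0 \<le> t" for t
    using q d_cone that
    by (auto simp: poly_T_eq excess_add excess_scaleR d_excess intro: cone_CT_add cone_CT_scaleR)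
  then have le: "norm (?q + t *\<^sub>R ?d) \<le> B" if "0 \<le> t" for t
    using B that by blast
  have "1 + t \<le> B" if "0 \<le> t" for t
  proof -
    have "1 + t = fst (?q + t *\<^sub>R ?d) $ v"
      using v by (simp add: subgraph_vec_def)
    also have "\<dots> \<le> norm (fst (?q + t *\<^sub>R ?d))"
      using component_le_norm_cart by (rule order_trans[OF abs_ge_self])
    also have "\<dots> \<le> norm (?q + t *\<^sub>R ?d)"
      by (metis norm_fst_le prod.collapse)
    also have "\<dots> \<le> B" by (rule le[OF that])
    finally show ?thesis .
  qed
  \<comment> \<open>The maximum with 0 keeps the parameter admissible, and
    \<open>1 + max B 0 \<le> B\<close> is impossible.\<close>
  from this[of "max B 0"] show False by auto
qed

theorem theorem1p2:
  fixes V :: "'a::finite set" and E :: "'a set set"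
  assumes "simple_graph V E"
  shows "chordal V E \<longleftrightarrow> binary_polyhedron (poly_T V E)"
proof
  show "binary_polyhedron (poly_T V E)" if "chordal V E"
    using chordal_imp_binary[OF assms that] .
  show "chordal V E" if "binary_polyhedron (poly_T V E)"
    using that hole_imp_unbounded[OF assms] polytope_imp_bounded
    by (auto simp: chordal_def binary_polyhedron_def)
qed

end
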